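(* Let $(P,\eta)$ be a complex projective structure on a Riemann surface $S$. For a complex chart $(U,z)$ of $S$ define, on meromorphic quartic differentials on $U$ with values in meromorphic quadratic differentials on $U$, $$\mathfrak d_{(U,z)}(Z\,dz^4)=\Big(\frac12\frac{Z''}{Z}-\frac{9}{16}\frac{Z'^2}{Z^2}\Big)dz^2,\qquad \mathfrak d_{(U,z)}(0)=0,$$ where $'$ is differentiation with respect to $z$. Then, for charts adapted to $(P,\eta)$, the operator $\mathfrak d_{(U,z)}$ is independent of the choice of the chart: if $(U,z)$ and $(U,\tilde z)$ are both adapted to $(P,\eta)$, then $\mathfrak d_{(U,z)}=\mathfrak d_{(U,\tilde z)}$.
   Context: $\mathrm{SL}(2,\mathbb{C})_1$ is the group of upper triangular $2\times2$ unimodular matrices. A complex projective structure on $S$ is a holomorphic principal $\mathrm{SL}(2,\mathbb{C})_1$-bundle $P\to S$ with a holomorphic $\mathfrak{sl}(2,\mathbb{C})$-valued Cartan connection $\eta$. $\mathbf a_2^1$ is the $2\times2$ matrix with $1$ in the $(2,1)$ place and $0$ elsewhere. A chart $(U,z)$ is adapted to $(P,\eta)$ if there is a holomorphic cross section $\mathfrak p:U\to P$ with $\mathfrak p^*(\eta)=\mathbf a_2^1\,dz$. *)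

theory Defs
  imports "HOL-Complex_Analysis.Complex_Analysis"
begin

section \<open>Complex manifolds\<close>

text \<open>
  A chart is a pair \<open>(U, \<phi>)\<close>; the values of \<open>\<phi>\<close> outside \<open>U\<close> are irrelevant, and the local inverse
  of \<open>\<phi>\<close> is \<open>inv_into U \<phi>\<close>.
\<close>

type_synonym ('a, 'e) chart = "'a set \<times> ('a \<Rightarrow> 'e)"

definition is_chart :: "('a::topological_space, 'e::topological_space) chart \<Rightarrow> bool" where
  "is_chart = (\<lambda>(U, \<phi>). open U \<and> open (\<phi> ` U) \<and> homeomorphism U (\<phi> ` U) \<phi> (inv_into U \<phi>))"

text \<open>The parameter \<open>hol\<close> is the notion of holomorphic self-map of the model space.\<close>

definition compatible ::
    "(('e \<Rightarrow> 'e) \<Rightarrow> 'e set \<Rightarrow> bool) \<Rightarrow> ('a, 'e) chart \<Rightarrow> ('a, 'e) chart \<Rightarrow> bool" where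
  "compatible hol = (\<lambda>(U, \<phi>) (V, \<psi>).
     hol (\<psi> \<circ> inv_into U \<phi>) (\<phi> ` (U \<inter> V)) \<and> hol (\<phi> \<circ> inv_into V \<psi>) (\<psi> ` (U \<inter> V)))"

definition maximal_atlas ::
    "(('e \<Rightarrow> 'e) \<Rightarrow> 'e set \<Rightarrow> bool) \<Rightarrow> ('a::topological_space, 'e::topological_space) chart set \<Rightarrow> bool"
  where
  "maximal_atlas hol A \<longleftrightarrow>
     (\<forall>c\<in>A. is_chart c) \<and> (\<Union>c\<in>A. fst c) = UNIV \<and>
     (\<forall>c\<in>A. \<forall>d\<in>A. compatible hol c d) \<and>
     (\<forall>c. is_chart c \<and> (\<forall>d\<in>A. compatible hol c d) \<longrightarrow> c \<in> A)"

text \<open>A complex manifold is given by its maximal atlas; the carrier is the whole type.\<close>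

definition riemann_surface :: "('a::t2_space, complex) chart set \<Rightarrow> bool" where
  "riemann_surface S \<longleftrightarrow>
     connected (UNIV :: 'a set) \<and> maximal_atlas (\<lambda>f A. f holomorphic_on A) S"

definition mholomorphic_on :: "(complex^'n \<Rightarrow> complex) \<Rightarrow> (complex^'n) set \<Rightarrow> bool" where
  "mholomorphic_on f A \<longleftrightarrow>
     (\<forall>x\<in>A. \<exists>f'. (f has_derivative f') (at x) \<and> Vector_Spaces.linear (*s) (*) f')"

definition complex_manifold :: "('a::t2_space, complex^'n) chart set \<Rightarrow> bool" where
  "complex_manifold P \<longleftrightarrow> maximal_atlas (\<lambda>f A. \<forall>i. mholomorphic_on (\<lambda>x. f x $ i) A) P"


section \<open>The groups and Lie algebras\<close>

definition SL2_1 :: "(complex^2^2) set" where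
  "SL2_1 = {g. g $ 2 $ 1 = 0 \<and> det g = 1}"

definition sl2 :: "(complex^2^2) set" where
  "sl2 = {X. trace X = 0}"

definition sl2_1 :: "(complex^2^2) set" where
  "sl2_1 = {X \<in> sl2. X $ 2 $ 1 = 0}"

definition a21 :: "complex^2^2" where
  "a21 = (\<chi> i j. if i = 2 \<and> j = 1 then 1 else 0)"

text \<open>
  The inverse of the global chart \<open>g \<mapsto> (g\<^sub>1\<^sub>1, g\<^sub>1\<^sub>2)\<close> of \<open>SL2_1\<close>, whose image is \<open>a \<noteq> 0\<close>.
\<close>

definition upper :: "complex \<times> complex \<Rightarrow> complex^2^2" where
  "upper = (\<lambda>(a, b). vector [vector [a, b], vector [0, inverse a]])"


section \<open>Holomorphic principal bundles\<close>

text \<open>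
  \<open>act p g\<close> is the right action. A local trivialization over the domain \<open>U\<close> of a chart \<open>z\<close> of the
  base is an equivariant map \<open>\<tau> : \<pi>\<^sup>-\<^sup>1(U) \<rightarrow> SL2_1\<close> such that \<open>p \<mapsto> (\<pi> p, \<tau> p)\<close> is biholomorphic onto
  \<open>U \<times> SL2_1\<close>. As \<open>(z, g\<^sub>1\<^sub>1, g\<^sub>1\<^sub>2)\<close> is a chart of \<open>U \<times> SL2_1\<close>, the latter says that
  \<open>p \<mapsto> (z (\<pi> p), (\<tau> p)\<^sub>1\<^sub>1, (\<tau> p)\<^sub>1\<^sub>2)\<close> is a chart of the total space with the full image.
\<close>

definition trivialization ::
    "('p::t2_space, complex^3) chart set \<Rightarrow> ('p \<Rightarrow> 'a::t2_space) \<Rightarrow> ('p \<Rightarrow> complex^2^2 \<Rightarrow> 'p) \<Rightarrow>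
     ('a, complex) chart \<Rightarrow> ('p \<Rightarrow> complex^2^2) \<Rightarrow> bool" where
  "trivialization P \<pi> act = (\<lambda>(U, z) \<tau>.
     (\<forall>p\<in>\<pi> -` U. \<tau> p \<in> SL2_1 \<and> (\<forall>g\<in>SL2_1. \<tau> (act p g) = \<tau> p ** g)) \<and>
     (let \<Phi> = (\<lambda>p. vector [z (\<pi> p), \<tau> p $ 1 $ 1, \<tau> p $ 1 $ 2])
      in (\<pi> -` U, \<Phi>) \<in> P \<and> \<Phi> ` (\<pi> -` U) = {v. v $ 1 \<in> z ` U \<and> v $ 2 \<noteq> 0}))"

definition principal_bundle ::
    "('a::t2_space, complex) chart set \<Rightarrow> ('p::t2_space, complex^3) chart set \<Rightarrow>
     ('p \<Rightarrow> 'a) \<Rightarrow> ('p \<Rightarrow> complex^2^2 \<Rightarrow> 'p) \<Rightarrow> bool" where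
  "principal_bundle S P \<pi> act \<longleftrightarrow>
     complex_manifold P \<and>
     (\<forall>p. act p (mat 1) = p) \<and>
     (\<forall>p. \<forall>g\<in>SL2_1. \<forall>h\<in>SL2_1. act (act p g) h = act p (g ** h)) \<and>
     (\<forall>p. \<forall>g\<in>SL2_1. \<pi> (act p g) = \<pi> p) \<and>
     (\<forall>x. \<exists>U z \<tau>. x \<in> U \<and> (U, z) \<in> S \<and> trivialization P \<pi> act (U, z) \<tau>)"


section \<open>Cartan connections\<close>

text \<open>
  A matrix-valued 1-form assigns to every chart \<open>c = (W, \<phi>)\<close>, every \<open>p \<in> W\<close> and every \<open>v\<close> its value
  on the tangent vector at \<open>p\<close> whose coordinates in the chart \<open>c\<close> are \<open>v\<close>; the third clause is the
  independence of the chart used to represent a tangent vector.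
\<close>

type_synonym 'p mform = "('p, complex^3) chart \<Rightarrow> 'p \<Rightarrow> complex^3 \<Rightarrow> complex^2^2"

definition holomorphic_sl2_form :: "('p::t2_space, complex^3) chart set \<Rightarrow> 'p mform \<Rightarrow> bool" where
  "holomorphic_sl2_form P \<eta> \<longleftrightarrow>
     (\<forall>(W, \<phi>)\<in>P. \<forall>p\<in>W.
        Vector_Spaces.linear (*s) (\<lambda>c X. mat c ** X) (\<eta> (W, \<phi>) p) \<and> range (\<eta> (W, \<phi>) p) \<subseteq> sl2) \<and>
     (\<forall>(W, \<phi>)\<in>P. \<forall>v i j. mholomorphic_on (\<lambda>t. \<eta> (W, \<phi>) (inv_into W \<phi> t) v $ i $ j) (\<phi> ` W)) \<and>
     (\<forall>(W, \<phi>)\<in>P. \<forall>(V, \<psi>)\<in>P. \<forall>p\<in>W \<inter> V. \<forall>v.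
        \<eta> (V, \<psi>) p (frechet_derivative (\<psi> \<circ> inv_into W \<phi>) (at (\<phi> p)) v) = \<eta> (W, \<phi>) p v)"

text \<open>
  The last two clauses are \<open>(R\<^sub>g)\<^sup>* \<eta> = Ad(g\<^sup>-\<^sup>1) \<eta>\<close> and \<open>\<eta>(X\<^sup>*) = X\<close>, where the fundamental vector field
  \<open>X\<^sup>*\<close> at \<open>p\<close> is the differential at the identity of the orbit map \<open>g \<mapsto> p g\<close>, applied to \<open>X\<close>.
  The identity is \<open>upper (1, 0)\<close>, and \<open>X \<in> sl2_1\<close> has coordinates \<open>(X\<^sub>1\<^sub>1, X\<^sub>1\<^sub>2)\<close> in the chart of the group.
\<close>

definition cartan_connection ::
    "('p::t2_space, complex^3) chart set \<Rightarrow> ('p \<Rightarrow> complex^2^2 \<Rightarrow> 'p) \<Rightarrow> 'p mform \<Rightarrow> bool" where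
  "cartan_connection P act \<eta> \<longleftrightarrow>
     holomorphic_sl2_form P \<eta> \<and>
     (\<forall>(W, \<phi>)\<in>P. \<forall>p\<in>W. bij_betw (\<eta> (W, \<phi>) p) UNIV sl2) \<and>
     (\<forall>(W, \<phi>)\<in>P. \<forall>(V, \<psi>)\<in>P. \<forall>g\<in>SL2_1. \<forall>p\<in>W. act p g \<in> V \<longrightarrow>
        (\<forall>v. \<eta> (V, \<psi>) (act p g)
               (frechet_derivative (\<lambda>t. \<psi> (act (inv_into W \<phi> t) g)) (at (\<phi> p)) v)
             = matrix_inv g ** \<eta> (W, \<phi>) p v ** g)) \<and>
     (\<forall>(W, \<phi>)\<in>P. \<forall>p\<in>W. \<forall>X\<in>sl2_1.
        \<eta> (W, \<phi>) p
          (frechet_derivative (\<lambda>s. \<phi> (act p (upper s))) (at (1, 0)) (X $ 1 $ 1, X $ 1 $ 2)) = X)"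

definition complex_projective_structure ::
    "('a::t2_space, complex) chart set \<Rightarrow> ('p::t2_space, complex^3) chart set \<Rightarrow>
     ('p \<Rightarrow> 'a) \<Rightarrow> ('p \<Rightarrow> complex^2^2 \<Rightarrow> 'p) \<Rightarrow> 'p mform \<Rightarrow> bool" where
  "complex_projective_structure S P \<pi> act \<eta> \<longleftrightarrow>
     principal_bundle S P \<pi> act \<and> cartan_connection P act \<eta>"


section \<open>Adapted charts\<close>

definition holomorphic_section ::
    "('p::t2_space, complex^3) chart set \<Rightarrow> ('p \<Rightarrow> 'a::t2_space) \<Rightarrow> ('a, complex) chart \<Rightarrow>
     ('a \<Rightarrow> 'p) \<Rightarrow> bool" where
  "holomorphic_section P \<pi> = (\<lambda>(U, z) \<pp>.
     (\<forall>x\<in>U. \<pi> (\<pp> x) = x) \<and> continuous_on U \<pp> \<and>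
     (\<forall>(W, \<phi>)\<in>P. \<forall>i.
        (\<lambda>t. \<phi> (\<pp> (inv_into U z t)) $ i) holomorphic_on z ` (U \<inter> \<pp> -` W)))"

text \<open>
  \<open>\<pp>\<^sup>* \<eta> = a21 dz\<close>: the differential of \<open>\<pp>\<close> maps the coordinate vector field of \<open>z\<close>, on which \<open>dz\<close>
  is 1, to a vector on which \<open>\<eta>\<close> is \<open>a21\<close>.
\<close>

definition adapted ::
    "('a::t2_space, complex) chart set \<Rightarrow> ('p::t2_space, complex^3) chart set \<Rightarrow>
     ('p \<Rightarrow> 'a) \<Rightarrow> 'p mform \<Rightarrow> ('a, complex) chart \<Rightarrow> bool" where
  "adapted S P \<pi> \<eta> = (\<lambda>(U, z). (U, z) \<in> S \<and>
     (\<exists>\<pp>. holomorphic_section P \<pi> (U, z) \<pp> \<and>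
       (\<forall>(W, \<phi>)\<in>P. \<forall>x\<in>U. \<pp> x \<in> W \<longrightarrow>
          \<eta> (W, \<phi>) (\<pp> x) (\<chi> i. deriv (\<lambda>t. \<phi> (\<pp> (inv_into U z t)) $ i) (z x)) = a21)))"


section \<open>Meromorphic differentials and the operator\<close>

text \<open>
  A differential \<open>Q\<close> of degree \<open>k\<close> on an open set \<open>U\<close> is given by its coefficients with respect to all
  charts, \<open>Q = Q (V, w) dw\<^sup>k\<close> on \<open>U \<inter> V\<close>. To have each meromorphic differential represented
  by exactly one \<open>Q\<close>, removable singularities are removed, and the coefficients are 0 at
  poles and outside \<open>U \<inter> V\<close>.
\<close>

type_synonym 'a differential = "('a, complex) chart \<Rightarrow> 'a \<Rightarrow> complex"

definition meromorphic_differentials ::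
    "('a::t2_space, complex) chart set \<Rightarrow> 'a set \<Rightarrow> nat \<Rightarrow> 'a differential set" where
  "meromorphic_differentials S U k = {Q.
     (\<forall>(V, w)\<in>S. (Q (V, w) \<circ> inv_into V w) nicely_meromorphic_on w ` (U \<inter> V)) \<and>
     (\<forall>(V, w)\<in>S. \<forall>(V', w')\<in>S. \<forall>x\<in>U \<inter> V \<inter> V'.
        Q (V, w) x = Q (V', w') x * deriv (w' \<circ> inv_into V w) (w x) ^ k) \<and>
     (\<forall>V w x. (V, w) \<notin> S \<or> x \<notin> U \<inter> V \<longrightarrow> Q (V, w) x = 0)}"

text \<open>The differential \<open>f(z) dz\<^sup>k\<close> on \<open>U\<close>, for a function \<open>f\<close> on \<open>z(U)\<close>.\<close>

definition differential_of ::
    "('a::t2_space, complex) chart set \<Rightarrow> ('a, complex) chart \<Rightarrow> nat \<Rightarrow> (complex \<Rightarrow> complex) \<Rightarrow>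
     'a differential" where
  "differential_of S = (\<lambda>(U, z) k f (V, w) x.
     if (V, w) \<in> S \<and> x \<in> U \<inter> V then f (z x) * deriv (z \<circ> inv_into V w) (w x) ^ k else 0)"

text \<open>
  \<open>Z\<close> is the coefficient of \<open>Q\<close> in the chart \<open>(U, z)\<close>, as a function of the coordinate, and
  \<^const>\<open>remove_sings\<close> turns the expression in \<open>Z\<close> into the normalized representative of that
  meromorphic function. If \<open>U\<close> is disconnected, a component on which \<open>Z\<close> is identically 0
  contributes 0, since \<open>x / 0 = 0\<close>.
\<close>

definition dop ::
    "('a::t2_space, complex) chart set \<Rightarrow> ('a, complex) chart \<Rightarrow> 'a differential \<Rightarrow> 'a differential"
  where
  "dop S = (\<lambda>(U, z). \<lambda>Q\<in>meromorphic_differentials S U 4.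
     if Q = (\<lambda>_ _. 0) then (\<lambda>_ _. 0)
     else let Z = Q (U, z) \<circ> inv_into U z
          in differential_of S (U, z) 2
               (remove_sings (\<lambda>t. 1/2 * (deriv (deriv Z) t / Z t) - 9/16 * ((deriv Z t)\<^sup>2 / (Z t)\<^sup>2))))"


subsection \<open>The operator takes values in meromorphic quadratic differentials\<close>

lemma transition:
  assumes "maximal_atlas (\<lambda>f A. f holomorphic_on A) S" "(U,z) \<in> S" "(V,w) \<in> S"
  shows "open (w ` (U \<inter> V))" "(z \<circ> inv_into V w) holomorphic_on w ` (U \<inter> V)"
    "inj_on w V" "inj_on z U" "inj_on (z \<circ> inv_into V w) (w ` (U \<inter> V))"
    "\<And>t. t \<in> w ` (U \<inter> V) \<Longrightarrow> deriv (z \<circ> inv_into V w) t \<noteq> 0"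
proof -
  have cU: "is_chart (U,z)" and cV: "is_chart (V,w)" and comp: "compatible (\<lambda>f A. f holomorphic_on A) (U,z) (V,w)"
    using assms unfolding maximal_atlas_def by blast+
  have oU: "open U" "open (z ` U)" and hU: "homeomorphism U (z ` U) z (inv_into U z)"
    using cU by (auto simp: is_chart_def)
  have oV: "open V" "open (w ` V)" and hV: "homeomorphism V (w ` V) w (inv_into V w)"
    using cV by (auto simp: is_chart_def)
  have "openin (top_of_set (w ` V)) (w ` (U \<inter> V))"
    using hV by (rule homeomorphism_imp_open_map) (use oU oV in \<open>auto simp: openin_open\<close>)
  then show o: "open (w ` (U \<inter> V))" using oV(2) openin_open_eq by blast
  show hol: "(z \<circ> inv_into V w) holomorphic_on w ` (U \<inter> V)"
    using comp by (simp add: compatible_def)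
  show iw: "inj_on w V" using hV by (metis homeomorphism_def inj_on_inverseI)
  show iz: "inj_on z U" using hU by (metis homeomorphism_def inj_on_inverseI)
  show inj: "inj_on (z \<circ> inv_into V w) (w ` (U \<inter> V))"
    using iw iz by (auto simp: inj_on_def)
  show "\<And>t. t \<in> w ` (U \<inter> V) \<Longrightarrow> deriv (z \<circ> inv_into V w) t \<noteq> 0"
    using holomorphic_injective_imp_regular[OF hol o inj] by blast
qed

lemma transition_chain:
  assumes S: "maximal_atlas (\<lambda>f A. f holomorphic_on A) S" and U: "(U,z) \<in> S" and V: "(V,w) \<in> S" and V': "(V',w') \<in> S"
    and x: "x \<in> U \<inter> V \<inter> V'"
  shows "deriv (z \<circ> inv_into V w) (w x) = deriv (z \<circ> inv_into V' w') (w' x) * deriv (w' \<circ> inv_into V w) (w x)"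
proof -
  note a = transition[OF S U V] and b = transition[OF S U V'] and c = transition[OF S V' V]
  have fx: "(w' \<circ> inv_into V w) (w x) = w' x" using x a(3) by simp
  have d1: "(w' \<circ> inv_into V w) field_differentiable at (w x)"
    using c(1,2) x holomorphic_on_imp_differentiable_at by blast
  have d2: "(z \<circ> inv_into V' w') field_differentiable at ((w' \<circ> inv_into V w) (w x))"
    unfolding fx using b(1,2) x holomorphic_on_imp_differentiable_at by blast
  have op: "open (w ` (U \<inter> V) \<inter> w ` (V' \<inter> V))" using a(1) c(1) by auto
  have ev: "\<forall>\<^sub>F t in nhds (w x). (z \<circ> inv_into V w) t = ((z \<circ> inv_into V' w') \<circ> (w' \<circ> inv_into V w)) t"
    unfolding eventually_nhds
  proof (intro exI conjI ballI)
    show "open (w ` (U \<inter> V) \<inter> w ` (V' \<inter> V))" by fact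
    show "w x \<in> w ` (U \<inter> V) \<inter> w ` (V' \<inter> V)" using x by auto
    fix t assume "t \<in> w ` (U \<inter> V) \<inter> w ` (V' \<inter> V)"
    then obtain y where "t = w y" "y \<in> V" "y \<in> V'" using a(3) by (auto simp: inj_on_def)
    then show "(z \<circ> inv_into V w) t = ((z \<circ> inv_into V' w') \<circ> (w' \<circ> inv_into V w)) t"
      using a(3) b(3) by simp
  qed
  show ?thesis
    using trans[OF deriv_cong_ev[OF ev refl] deriv_chain[OF d1 d2]] unfolding fx .
qed

lemma differential_of_in_meromorphic_differentials:
  assumes S: "maximal_atlas (\<lambda>f A. f holomorphic_on A) S" and U: "(U,z) \<in> S"
    and f: "f nicely_meromorphic_on z ` U"
  shows "differential_of S (U,z) k f \<in> meromorphic_differentials S U k"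
proof -
  have "(differential_of S (U,z) k f (V,w) \<circ> inv_into V w) nicely_meromorphic_on w ` (U \<inter> V)"
    if V: "(V,w) \<in> S" for V w
  proof -
    note a = transition[OF S U V]
    let ?\<tau> = "z \<circ> inv_into V w" and ?A = "w ` (U \<inter> V)"
    let ?g = "\<lambda>t. f (?\<tau> t) * deriv ?\<tau> t ^ k"
    let ?h = "differential_of S (U,z) k f (V,w) \<circ> inv_into V w"
    have an: "?\<tau> analytic_on ?A" using a(1,2) analytic_on_open by blast
    have im: "?\<tau> ` ?A \<subseteq> z ` U" using a(3) by auto
    have eq: "?h t = ?g t" if "t \<in> ?A" for t
      using that a(3) V by (auto simp: differential_of_def)
    have mg: "?g meromorphic_on ?A"
      by (intro meromorphic_intros meromorphic_on_compose[OF _ an im] analytic_on_imp_meromorphic_on[OF an])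
        (use f in \<open>auto simp: nicely_meromorphic_on_def\<close>)
    have evn: "\<forall>\<^sub>F u in nhds t. ?h u = ?g u" if "t \<in> ?A" for t
      using eq that a(1) unfolding eventually_nhds by blast
    have ev: "\<forall>\<^sub>F u in at t. ?h u = ?g u" if "t \<in> ?A" for t
      using evn[OF that] by (simp add: eventually_nhds_conv_at)
    have mh: "?h meromorphic_on ?A"
      using mg meromorphic_on_cong[of ?A ?h ?g ?A] ev by blast
    have "(is_pole ?h t \<and> ?h t = 0) \<or> ?h \<midarrow>t\<rightarrow> ?h t" if t: "t \<in> ?A" for t
    proof -
      have tU: "?\<tau> t \<in> z ` U" using im t by blast
      have at: "?\<tau> analytic_on {t}" by (rule analytic_on_subset[OF an]) (use t in simp)
      then have ct: "?\<tau> \<midarrow>t\<rightarrow> ?\<tau> t" by (intro isContD analytic_at_imp_isCont)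
      have fl: "filterlim ?\<tau> (at (?\<tau> t)) (at t)"
        unfolding filterlim_at
      proof
        have "?\<tau> x \<noteq> ?\<tau> t" if "x \<in> ?A" "x \<noteq> t" for x
          using inj_onD[OF a(5) _ that(1) t] that(2) by blast
        then show "\<forall>\<^sub>F x in at t. ?\<tau> x \<in> UNIV \<and> ?\<tau> x \<noteq> ?\<tau> t"
          using a(1) t unfolding eventually_at_topological by (intro exI[of _ ?A]) simp
      qed (rule ct)
      have dt: "(\<lambda>u. deriv ?\<tau> u ^ k) \<midarrow>t\<rightarrow> deriv ?\<tau> t ^ k"
        by (intro tendsto_power isContD analytic_at_imp_isCont analytic_deriv at)
      consider "is_pole f (?\<tau> t)" "f (?\<tau> t) = 0" | "f \<midarrow>?\<tau> t\<rightarrow> f (?\<tau> t)"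
        using f tU unfolding nicely_meromorphic_on_def by blast
      then show ?thesis
      proof cases
        case 1
        have "filterlim (\<lambda>u. f (?\<tau> u)) at_infinity (at t)"
          using 1(1) fl unfolding is_pole_def by (rule filterlim_compose)
        from tendsto_mult_filterlim_at_infinity[OF dt _ this] a(6)[OF t]
        have "filterlim ?g at_infinity (at t)" by (simp add: mult.commute)
        then have "filterlim ?h at_infinity (at t)"
          unfolding filterlim_cong[OF refl refl ev[OF t]] .
        then have "is_pole ?h t" unfolding is_pole_def .
        moreover have "?h t = 0" unfolding eq[OF t] using 1(2) by simp
        ultimately show ?thesis by blast
      next
        case 2
        have "(\<lambda>u. f (?\<tau> u)) \<midarrow>t\<rightarrow> f (?\<tau> t)" using 2 fl by (rule filterlim_compose)
        then have "?g \<midarrow>t\<rightarrow> ?g t" using dt by (rule tendsto_mult)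
        then have "?h \<midarrow>t\<rightarrow> ?g t" unfolding tendsto_cong[OF ev[OF t]] .
        then show ?thesis unfolding eq[OF t] by blast
      qed
    qed
    with mh show ?thesis by (auto simp: nicely_meromorphic_on_def)
  qed
  moreover have "differential_of S (U,z) k f (V, w) x =
      differential_of S (U,z) k f (V', w') x * deriv (w' \<circ> inv_into V w) (w x) ^ k"
    if "(V,w) \<in> S" "(V',w') \<in> S" "x \<in> U \<inter> V \<inter> V'" for V w V' w' x
    using transition_chain[OF S U that] that
    by (simp add: differential_of_def power_mult_distrib)
  ultimately show ?thesis
    by (auto simp: meromorphic_differentials_def differential_of_def)
qed

lemma dop_in_meromorphic_differentials:
  assumes "riemann_surface S" "(U,z) \<in> S"
  shows "dop S (U,z) \<in> meromorphic_differentials S U 4 \<rightarrow>\<^sub>E meromorphic_differentials S U 2"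
proof -
  have S: "maximal_atlas (\<lambda>f A. f holomorphic_on A) S" using assms(1) by (simp add: riemann_surface_def)
  have "dop S (U,z) Q \<in> meromorphic_differentials S U 2" if Q: "Q \<in> meromorphic_differentials S U 4" for Q
  proof (cases "Q = (\<lambda>_ _. 0)")
    case True
    then have "dop S (U,z) Q = (\<lambda>_ _. 0)" using Q by (simp add: dop_def)
    then show ?thesis by (auto simp: meromorphic_differentials_def o_def)
  next
    case False
    let ?Z = "Q (U,z) \<circ> inv_into U z"
    have "?Z nicely_meromorphic_on z ` (U \<inter> U)" using Q assms(2) unfolding meromorphic_differentials_def by blast
    then have Z: "?Z meromorphic_on z ` U" by (simp add: nicely_meromorphic_on_def)
    have "remove_sings (\<lambda>t. 1/2 * (deriv (deriv ?Z) t / ?Z t) - 9/16 * ((deriv ?Z t)\<^sup>2 / (?Z t)\<^sup>2)) nicely_meromorphic_on z ` U"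
      by (intro remove_sings_nicely_meromorphic meromorphic_intros Z)
    from differential_of_in_meromorphic_differentials[OF S assms(2) this, of 2] show ?thesis
      using Q False by (simp add: dop_def Let_def)
  qed
  then show ?thesis by (auto simp: dop_def)
qed

end

theory Submission
  imports Defs
begin

text \<open>
  Two sections \<open>p\<close>, \<open>q\<close> of \<open>P\<close> that make \<open>z\<close> and \<open>z'\<close> adapted differ by a gauge transformation:
  \<open>q = p g\<close> with \<open>g = upper (a, b)\<close>, where \<open>a\<close> and \<open>b\<close> are holomorphic functions of the coordinate
  \<open>t = z\<close>. The two characteristic properties of a Cartan connection, equivariance and
  reproduction of fundamental vector fields, give the transformation law
  \<open>q\<^sup>* \<eta> = g\<^sup>-\<^sup>1 (p\<^sup>* \<eta>) g + g\<^sup>-\<^sup>1 dg\<close> (\<open>connection_gauge_transformation\<close>).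
  Write \<open>\<zeta> = z' \<circ> z\<^sup>-\<^sup>1\<close> for the coordinate change. Since \<open>p\<^sup>* \<eta> = a21 dz\<close> and
  \<open>q\<^sup>* \<eta> = a21 dz' = \<zeta>' a21 dz\<close>, comparison of matrix entries yields
  \[ \<zeta>' = a^2, \qquad a' = b a^2, \qquad b' = 0 \]
  (\<open>adapted_transition_equations\<close>). As \<open>(1/a)' = -b\<close> is locally constant, these equations say that
  \<open>\<zeta>\<close> is locally a Moebius transformation.

  A quartic differential satisfies \<open>Z = (Y \<circ> \<zeta>) (\<zeta>')\<^sup>4 = (Y \<circ> \<zeta>) a\<^sup>8\<close>. Differentiating with the three
  equations turns every derivative of \<open>a\<close> into a polynomial in \<open>a\<close> and \<open>b\<close>:
  \[ Z''/Z = (Y''/Y) a^4 + 18 b (Y'/Y) a^3 + 72 b^2 a^2, \qquad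
     (Z'/Z)^2 = (Y'/Y)^2 a^4 + 16 b (Y'/Y) a^3 + 64 b^2 a^2, \]
  with \<open>Y\<close> and its derivatives taken at \<open>\<zeta>\<close>. Up to a common factor, \<open>1/2\<close> and \<open>-9/16\<close> are the
  coefficients for which both terms containing \<open>b\<close> cancel, which leaves the transformation law of a quadratic
  differential (\<open>quartic_operator_covariant\<close>). This settles the points where \<open>Y\<close> is analytic; the
  remaining points are isolated, and normalized meromorphic coefficients are determined by their
  values nearby (\<open>nicely_meromorphic_eqI\<close>).
\<close>

no_notation fps_nth (infixl "$" 75) \<comment> \<open>\<open>$\<close> selects the component of a vector.\<close>

section \<open>Covariance of the quartic operator\<close>

definition quartic_operator :: "(complex \<Rightarrow> complex) \<Rightarrow> complex \<Rightarrow> complex" where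
  "quartic_operator Z t = 1/2 * (deriv (deriv Z) t / Z t) - 9/16 * ((deriv Z t)\<^sup>2 / (Z t)\<^sup>2)"

text \<open>
  The equations on \<open>\<zeta>\<close>, \<open>a\<close>, \<open>b\<close> describe a Moebius coordinate change. If \<open>Y\<close> vanishes at
  \<open>\<zeta> t\<close>, both sides are 0 because division by 0 gives 0.
\<close>

lemma quartic_operator_covariant:
  assumes "open D" "t \<in> D"
    and a0: "a t \<noteq> 0"
    and \<zeta>': "\<And>s. s \<in> D \<Longrightarrow> (\<zeta> has_field_derivative a s ^ 2) (at s)"
    and a': "\<And>s. s \<in> D \<Longrightarrow> (a has_field_derivative b s * a s ^ 2) (at s)"
    and b': "\<And>s. s \<in> D \<Longrightarrow> (b has_field_derivative 0) (at s)"
    and Z: "\<And>s. s \<in> D \<Longrightarrow> Z s = Y (\<zeta> s) * (a s ^ 2) ^ 4"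
    and Y: "Y analytic_on {\<zeta> t}"
  shows "quartic_operator Z t = quartic_operator Y (\<zeta> t) * (a t ^ 2) ^ 2"
proof -
  obtain B where B: "open B" "\<zeta> t \<in> B" "Y holomorphic_on B"
    using Y by (metis analytic_at)
  have "continuous_on D \<zeta>"
    using \<zeta>' by (meson DERIV_isCont continuous_at_imp_continuous_on)
  define E where "E = D \<inter> \<zeta> -` B"
  have oE: "open E"
    unfolding E_def using continuous_open_preimage[OF \<open>continuous_on D \<zeta>\<close> \<open>open D\<close> \<open>open B\<close>] .
  have tE: "t \<in> E" using assms(2) B(2) by (simp add: E_def)
  have Y1: "(Y has_field_derivative deriv Y u) (at u)" if "u \<in> B" for u
    using holomorphic_derivI[OF B(3,1) that] .
  have Y2: "(deriv Y has_field_derivative deriv (deriv Y) u) (at u)" if "u \<in> B" for u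
    using holomorphic_derivI[OF holomorphic_deriv[OF B(3,1)] B(1) that] .
  have YC: "((\<lambda>s. Y (\<zeta> s)) has_field_derivative deriv Y (\<zeta> s) * a s ^ 2) (at s)" if "s \<in> E" for s
    using DERIV_chain2[OF Y1 \<zeta>'] that by (simp add: E_def)
  have YC': "((\<lambda>s. deriv Y (\<zeta> s)) has_field_derivative deriv (deriv Y) (\<zeta> s) * a s ^ 2) (at s)"
    if "s \<in> E" for s
    using DERIV_chain2[OF Y2 \<zeta>'] that by (simp add: E_def)
  define Z1 where "Z1 s = deriv Y (\<zeta> s) * a s ^ 10 + 8 * b s * Y (\<zeta> s) * a s ^ 9" for s
  have d1: "deriv Z s = Z1 s" if s: "s \<in> E" for s
  proof -
    have "((\<lambda>s. Y (\<zeta> s) * a s ^ 8) has_field_derivative Z1 s) (at s)"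
      by (rule derivative_eq_intros YC[OF s] a' refl)+
        (use s in \<open>auto simp: E_def Z1_def algebra_simps eval_nat_numeral\<close>)
    then have "(Z has_field_derivative Z1 s) (at s)"
      by (rule has_field_derivative_transform_within_open[OF _ oE s]) (simp add: E_def Z flip: power_mult)
    then show ?thesis by (rule DERIV_imp_deriv)
  qed
  define Z2 where "Z2 = deriv (deriv Y) (\<zeta> t) * a t ^ 12 + 18 * b t * deriv Y (\<zeta> t) * a t ^ 11
    + 72 * b t ^ 2 * Y (\<zeta> t) * a t ^ 10"
  have d2: "deriv (deriv Z) t = Z2"
  proof -
    note at = a'[OF assms(2)] and bt = b'[OF assms(2)]
    have "(Z1 has_field_derivative Z2) (at t)"
      unfolding Z1_def
      by (rule DERIV_cong[OF DERIV_add[OF DERIV_mult[OF YC'[OF tE] DERIV_power[OF at]]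
              DERIV_mult[OF DERIV_mult[OF DERIV_cmult[OF bt] YC[OF tE]] DERIV_power[OF at]]]])
        (simp add: Z2_def algebra_simps eval_nat_numeral)
    then have "(deriv Z has_field_derivative Z2) (at t)"
      by (rule has_field_derivative_transform_within_open[OF _ oE tE]) (simp add: d1)
    then show ?thesis by (rule DERIV_imp_deriv)
  qed
  have Zt: "Z t = Y (\<zeta> t) * a t ^ 8" using Z[OF assms(2)] by (simp flip: power_mult)
  show ?thesis
  proof (cases "Y (\<zeta> t) = 0")
    case True
    then show ?thesis by (simp add: quartic_operator_def Zt)
  next
    case False
    with a0 show ?thesis
      unfolding quartic_operator_def d2 d1[OF tE] Zt Z1_def Z2_def
      by (simp add: divide_simps) (simp add: algebra_simps eval_nat_numeral)
  qed
qed

section \<open>Coordinates of a principal bundle\<close>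

text \<open>The chart of the total space that belongs to a local trivialization \<open>\<tau>\<close>.\<close>

definition frame_coords :: "('a \<Rightarrow> complex) \<Rightarrow> ('p \<Rightarrow> 'a) \<Rightarrow> ('p \<Rightarrow> complex^2^2) \<Rightarrow> 'p \<Rightarrow> complex^3" where
  "frame_coords w \<pi> \<tau> p = vector [w (\<pi> p), \<tau> p $ 1 $ 1, \<tau> p $ 1 $ 2]"

lemma vec3_eqI: "u $ 1 = v $ 1 \<Longrightarrow> u $ 2 = v $ 2 \<Longrightarrow> u $ 3 = v $ 3 \<Longrightarrow> u = (v::'a^3)"
  by (simp add: vec_eq_iff forall_3)

lemma upper_in_SL2_1: "a \<noteq> 0 \<Longrightarrow> upper (a, b) \<in> SL2_1"
  by (simp add: SL2_1_def upper_def det_2)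

lemma matrix_inv_upper:
  assumes "a \<noteq> 0"
  shows "matrix_inv (upper (a, b)) = vector [vector [1/a, -b], vector [0, a]]"
proof -
  let ?g = "upper (a, b)" and ?h = "vector [vector [1/a, -b], vector [0, a]] :: complex^2^2"
  have h: "?g ** ?h = mat 1" "?h ** ?g = mat 1"
    using assms
    by (simp_all add: upper_def vec_eq_iff forall_2 matrix_matrix_mult_def sum_2 mat_def inverse_eq_divide)
  have "?g ** matrix_inv ?g = mat 1 \<and> matrix_inv ?g ** ?g = mat 1"
    unfolding matrix_inv_def by (rule someI[of _ ?h]) (use h in blast)
  then have "matrix_inv ?g = (?h ** ?g) ** matrix_inv ?g" "?h = ?h ** (?g ** matrix_inv ?g)"
    using h by simp_all
  then show ?thesis by (simp add: matrix_mul_assoc)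
qed

lemma has_derivative_vec:
  fixes f :: "'a::real_normed_vector \<Rightarrow> 'b::euclidean_space^'n"
  assumes "\<And>i. ((\<lambda>x. f x $ i) has_derivative (\<lambda>h. f' h $ i)) (at x within s)"
  shows "(f has_derivative f') (at x within s)"
  by (subst has_derivative_componentwise_within)
    (use assms in \<open>auto simp: Basis_vec_def inner_axis intro!: has_derivative_inner_left\<close>)

lemma trivialization_facts:
  assumes "principal_bundle S P \<pi> act" and tr: "trivialization P \<pi> act (V, w) \<tau>"
  defines "W \<equiv> \<pi> -` V" and "\<Phi> \<equiv> frame_coords w \<pi> \<tau>"
  shows trivialization_chart: "(W, \<Phi>) \<in> P"
    and trivialization_open: "open (\<Phi> ` W)"
    and trivialization_inj: "inj_on \<Phi> W"
    and trivialization_nonzero: "\<And>p. \<pi> p \<in> V \<Longrightarrow> \<tau> p $ 1 $ 1 \<noteq> 0"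
    and trivialization_act: "\<And>p a b. \<pi> p \<in> V \<Longrightarrow> a \<noteq> 0 \<Longrightarrow>
      \<Phi> (act p (upper (a, b))) = vector [w (\<pi> p), \<tau> p $ 1 $ 1 * a, \<tau> p $ 1 $ 1 * b + \<tau> p $ 1 $ 2 / a]"
    and trivialization_act_fibre: "\<And>p a b. a \<noteq> 0 \<Longrightarrow> \<pi> (act p (upper (a, b))) = \<pi> p"
proof -
  have \<Phi>: "\<Phi> = (\<lambda>p. vector [w (\<pi> p), \<tau> p $ 1 $ 1, \<tau> p $ 1 $ 2])"
    by (simp add: \<Phi>_def frame_coords_def fun_eq_iff)
  show P: "(W, \<Phi>) \<in> P"
    using tr by (simp add: trivialization_def Let_def \<Phi> W_def)
  have im: "\<Phi> ` W = {v. v $ 1 \<in> w ` V \<and> v $ 2 \<noteq> 0}"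
    using tr by (simp add: trivialization_def Let_def \<Phi> W_def)
  have "\<forall>c\<in>P. is_chart c"
    using assms(1) unfolding principal_bundle_def complex_manifold_def maximal_atlas_def
    by (elim conjE)
  then have "is_chart (W, \<Phi>)" using P by blast
  then have "open (\<Phi> ` W)" "homeomorphism W (\<Phi> ` W) \<Phi> (inv_into W \<Phi>)"
    by (simp_all add: is_chart_def)
  then show "open (\<Phi> ` W)" "inj_on \<Phi> W"
    by (simp_all add: homeomorphism_def inj_on_inverseI[of W "inv_into W \<Phi>"])
  show "\<tau> p $ 1 $ 1 \<noteq> 0" if "\<pi> p \<in> V" for p
  proof -
    have "\<Phi> p \<in> {v. v $ 1 \<in> w ` V \<and> v $ 2 \<noteq> 0}" using that im by (auto simp: W_def)
    then show ?thesis by (simp add: \<Phi>)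
  qed
  show fib: "\<pi> (act p (upper (a, b))) = \<pi> p" if "a \<noteq> 0" for p a b
    using assms(1) upper_in_SL2_1[OF that] by (simp add: principal_bundle_def)
  show "\<Phi> (act p (upper (a, b))) = vector [w (\<pi> p), \<tau> p $ 1 $ 1 * a, \<tau> p $ 1 $ 1 * b + \<tau> p $ 1 $ 2 / a]"
    if "\<pi> p \<in> V" "a \<noteq> 0" for p a b
  proof -
    have "\<tau> (act p (upper (a, b))) = \<tau> p ** upper (a, b)"
      using tr that upper_in_SL2_1[OF that(2)] by (simp add: trivialization_def)
    then show ?thesis
      using fib[OF that(2)]
      by (simp add: \<Phi> upper_def matrix_matrix_mult_def sum_2 field_simps)
  qed
qed

text \<open>
  Two points of one fibre have the same first coordinate, so it suffices to find \<open>g\<close> that matches the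
  other two: \<open>g\<close> is the product of \<open>(\<tau> p)\<^sup>-\<^sup>1\<close> and \<open>\<tau> q\<close>. The explicit formula shows that \<open>g\<close>
  depends holomorphically on the base point when \<open>p\<close> and \<open>q\<close> do.
\<close>

lemma frames_over_same_point:
  assumes pb: "principal_bundle S P \<pi> act" and tr: "trivialization P \<pi> act (V, w) \<tau>"
    and p: "\<pi> p = x" and q: "\<pi> q = x" and x: "x \<in> V"
  shows "q = act p (upper (\<tau> q $ 1 $ 1 / \<tau> p $ 1 $ 1,
               \<tau> q $ 1 $ 2 / \<tau> p $ 1 $ 1 - \<tau> p $ 1 $ 2 / \<tau> q $ 1 $ 1))"
    (is "q = act p (upper (?a, ?b))")
proof -
  note F = trivialization_facts[OF pb tr]
  have nz: "\<tau> p $ 1 $ 1 \<noteq> 0" "\<tau> q $ 1 $ 1 \<noteq> 0" using F(4) p q x by auto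
  then have a: "?a \<noteq> 0" by simp
  have "frame_coords w \<pi> \<tau> (act p (upper (?a, ?b))) = frame_coords w \<pi> \<tau> q"
    using F(5)[OF _ a, of p ?b] p q x nz
    by (simp add: frame_coords_def) (simp add: field_simps)
  from inj_onD[OF F(3) this] show ?thesis using F(6)[OF a] p q x by simp
qed

section \<open>Gauge transformation of a Cartan connection\<close>

lemma cartan_equivariance:
  assumes cc: "cartan_connection P act \<eta>" and c: "(W, \<phi>) \<in> P" and d: "(V, \<psi>) \<in> P"
    and g: "g \<in> SL2_1" and p: "p \<in> W" and q: "act p g \<in> V"
  shows "\<eta> (V, \<psi>) (act p g) (frechet_derivative (\<lambda>t. \<psi> (act (inv_into W \<phi> t) g)) (at (\<phi> p)) v)
       = matrix_inv g ** \<eta> (W, \<phi>) p v ** g"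
proof -
  have "\<forall>(W, \<phi>)\<in>P. \<forall>(V, \<psi>)\<in>P. \<forall>g\<in>SL2_1. \<forall>p\<in>W. act p g \<in> V \<longrightarrow>
        (\<forall>v. \<eta> (V, \<psi>) (act p g)
               (frechet_derivative (\<lambda>t. \<psi> (act (inv_into W \<phi> t) g)) (at (\<phi> p)) v)
             = matrix_inv g ** \<eta> (W, \<phi>) p v ** g)"
    using cc unfolding cartan_connection_def by (elim conjE)
  from bspec[OF bspec[OF this c, unfolded prod.case] d, unfolded prod.case]
  show ?thesis using g p q by blast
qed

lemma cartan_fundamental:
  assumes cc: "cartan_connection P act \<eta>" and c: "(W, \<phi>) \<in> P" and p: "p \<in> W" and X: "X \<in> sl2_1"
  shows "\<eta> (W, \<phi>) p
      (frechet_derivative (\<lambda>s. \<phi> (act p (upper s))) (at (1, 0)) (X $ 1 $ 1, X $ 1 $ 2)) = X"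
proof -
  have "\<forall>(W, \<phi>)\<in>P. \<forall>p\<in>W. \<forall>X\<in>sl2_1.
        \<eta> (W, \<phi>) p
          (frechet_derivative (\<lambda>s. \<phi> (act p (upper s))) (at (1, 0)) (X $ 1 $ 1, X $ 1 $ 2)) = X"
    using cc unfolding cartan_connection_def by (elim conjE)
  from bspec[OF this c, unfolded prod.case] show ?thesis using p X by blast
qed

text \<open>
  In the coordinates of a trivialization, right translation by a fixed \<open>g\<close> is the restriction of a
  linear map, hence equal to its own derivative.
\<close>

lemma connection_right_translation:
  assumes pb: "principal_bundle S P \<pi> act" and tr: "trivialization P \<pi> act (V, w) \<tau>"
    and cc: "cartan_connection P act \<eta>" and p: "\<pi> p \<in> V" and a: "a \<noteq> 0"
  defines "c \<equiv> (\<pi> -` V, frame_coords w \<pi> \<tau>)"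
  shows "\<eta> c (act p (upper (a, b))) (vector [v $ 1, v $ 2 * a, v $ 2 * b + v $ 3 / a])
       = matrix_inv (upper (a, b)) ** \<eta> c p v ** upper (a, b)"
proof -
  note F = trivialization_facts[OF pb tr]
  let ?W = "\<pi> -` V" and ?\<Phi> = "frame_coords w \<pi> \<tau>" and ?g = "upper (a, b)"
  let ?L = "\<lambda>v::complex^3. vector [v $ 1, v $ 2 * a, v $ 2 * b + v $ 3 / a] :: complex^3"
  have nth: "((\<lambda>v. v $ i) has_derivative (\<lambda>h. h $ i)) (at u)" for i and u :: "complex^3"
    by (rule bounded_linear_imp_has_derivative) (rule bounded_linear_vec_nth)
  have "(?L has_derivative ?L) (at (?\<Phi> p))"
  proof (rule has_derivative_vec)
    fix i :: 3
    show "((\<lambda>v. ?L v $ i) has_derivative (\<lambda>v. ?L v $ i)) (at (?\<Phi> p))"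
      using exhaust_3[of i]
      by (auto intro!: derivative_eq_intros nth simp: a)
  qed
  then have "((\<lambda>t. ?\<Phi> (act (inv_into ?W ?\<Phi> t) ?g)) has_derivative ?L) (at (?\<Phi> p))"
  proof (rule has_derivative_transform_within_open[OF _ F(2)])
    show "?\<Phi> p \<in> ?\<Phi> ` ?W" using p by simp
    fix t assume "t \<in> ?\<Phi> ` ?W"
    then obtain r where r: "r \<in> ?W" "t = ?\<Phi> r" by blast
    then have "inv_into ?W ?\<Phi> t = r" using F(3) by simp
    moreover have "?\<Phi> (act r ?g) = ?L t"
      using F(5)[OF _ a, of r b] r by (simp add: frame_coords_def)
    ultimately show "?L t = ?\<Phi> (act (inv_into ?W ?\<Phi> t) ?g)" by simp
  qed
  then have "frechet_derivative (\<lambda>t. ?\<Phi> (act (inv_into ?W ?\<Phi> t) ?g)) (at (?\<Phi> p)) = ?L"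
    by (rule frechet_derivative_at[symmetric])
  moreover have "\<eta> c (act p ?g)
        (frechet_derivative (\<lambda>t. ?\<Phi> (act (inv_into ?W ?\<Phi> t) ?g)) (at (?\<Phi> p)) v)
      = matrix_inv ?g ** \<eta> c p v ** ?g"
    unfolding c_def
    by (rule cartan_equivariance[OF cc F(1) F(1) upper_in_SL2_1[OF a]])
      (use p F(6)[OF a] in simp_all)
  ultimately show ?thesis by simp
qed

text \<open>
  The vector on the left is the fundamental vector field at \<open>p\<close> of the matrix on the right: the
  derivative at the identity of the orbit map, computed in the coordinates of the trivialization.
\<close>

lemma connection_vertical:
  assumes pb: "principal_bundle S P \<pi> act" and tr: "trivialization P \<pi> act (V, w) \<tau>"
    and cc: "cartan_connection P act \<eta>" and p: "\<pi> p \<in> V"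
  shows "\<eta> (\<pi> -` V, frame_coords w \<pi> \<tau>) p
           (vector [0, \<tau> p $ 1 $ 1 * h, \<tau> p $ 1 $ 1 * k - \<tau> p $ 1 $ 2 * h])
       = vector [vector [h, k], vector [0, -h]]"
proof -
  note F = trivialization_facts[OF pb tr]
  let ?W = "\<pi> -` V" and ?\<Phi> = "frame_coords w \<pi> \<tau>"
  let ?X = "vector [vector [h, k], vector [0, -h]] :: complex^2^2"
  let ?M = "\<lambda>s::complex\<times>complex. vector [w (\<pi> p), \<tau> p $ 1 $ 1 * fst s, \<tau> p $ 1 $ 1 * snd s + \<tau> p $ 1 $ 2 / fst s] :: complex^3"
  let ?L = "\<lambda>s::complex\<times>complex. vector [0, \<tau> p $ 1 $ 1 * fst s, \<tau> p $ 1 $ 1 * snd s - \<tau> p $ 1 $ 2 * fst s] :: complex^3"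
  have "(?M has_derivative ?L) (at (1, 0))"
  proof (rule has_derivative_vec)
    fix i :: 3
    show "((\<lambda>v. ?M v $ i) has_derivative (\<lambda>v. ?L v $ i)) (at (1, 0))"
      using exhaust_3[of i]
      by (auto intro!: derivative_eq_intros)
  qed
  then have "((\<lambda>s. ?\<Phi> (act p (upper s))) has_derivative ?L) (at (1, 0))"
  proof (rule has_derivative_transform_within_open[where s = "(- {0}) \<times> UNIV"])
    fix s :: "complex \<times> complex" assume "s \<in> (- {0}) \<times> UNIV"
    then have "fst s \<noteq> 0" by auto
    from F(5)[OF p this, of "snd s"] show "?M s = ?\<Phi> (act p (upper s))" by simp
  next
    show "open ((- {0::complex}) \<times> (UNIV :: complex set))" by (intro open_Times) auto
  qed simp
  then have "frechet_derivative (\<lambda>s. ?\<Phi> (act p (upper s))) (at (1, 0)) = ?L"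
    by (rule frechet_derivative_at[symmetric])
  moreover have X: "?X \<in> sl2_1"
    by (simp add: sl2_1_def sl2_def trace_def sum_2)
  have "\<eta> (?W, ?\<Phi>) p
          (frechet_derivative (\<lambda>s. ?\<Phi> (act p (upper s))) (at (1, 0)) (?X $ 1 $ 1, ?X $ 1 $ 2)) = ?X"
    by (rule cartan_fundamental[OF cc F(1) _ X]) (use p in simp)
  ultimately show ?thesis by simp
qed

lemma
  assumes cc: "cartan_connection P act \<eta>" and c: "(W, \<phi>) \<in> P" "p \<in> W"
  shows connection_add: "\<eta> (W, \<phi>) p (u + v) = \<eta> (W, \<phi>) p u + \<eta> (W, \<phi>) p v"
    and connection_scale: "\<eta> (W, \<phi>) p (k *s v) = mat k ** \<eta> (W, \<phi>) p v"
proof -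
  have "\<forall>(W, \<phi>)\<in>P. \<forall>p\<in>W.
      Vector_Spaces.linear (*s) (\<lambda>c X. mat c ** X) (\<eta> (W, \<phi>) p) \<and> range (\<eta> (W, \<phi>) p) \<subseteq> sl2"
    using cc unfolding cartan_connection_def holomorphic_sl2_form_def by (elim conjE)
  from bspec[OF this c(1), unfolded prod.case]
  have "Vector_Spaces.linear (*s) (\<lambda>c X. mat c ** X) (\<eta> (W, \<phi>) p)" using c(2) by blast
  then interpret Vector_Spaces.linear "(*s)" "\<lambda>c X. mat c ** X" "\<eta> (W, \<phi>) p" .
  show "\<eta> (W, \<phi>) p (u + v) = \<eta> (W, \<phi>) p u + \<eta> (W, \<phi>) p v" by (rule add)
  show "\<eta> (W, \<phi>) p (k *s v) = mat k ** \<eta> (W, \<phi>) p v" by (rule scale)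
qed

text \<open>
  The vector on the left is the velocity of a curve \<open>p g\<close>, where \<open>v\<close> is the velocity of \<open>p\<close> and
  \<open>a'\<close>, \<open>b'\<close> are the derivatives of the entries of \<open>g\<close>. By the product rule it is the image of \<open>v\<close>
  under right translation by \<open>g\<close> plus a vertical vector. The last matrix is \<open>g\<^sup>-\<^sup>1 dg\<close>.
\<close>

lemma connection_gauge_transformation:
  assumes pb: "principal_bundle S P \<pi> act" and tr: "trivialization P \<pi> act (V, w) \<tau>"
    and cc: "cartan_connection P act \<eta>" and p: "\<pi> p \<in> V" and a: "a \<noteq> 0"
  defines "c \<equiv> (\<pi> -` V, frame_coords w \<pi> \<tau>)" and "\<alpha> \<equiv> \<tau> p $ 1 $ 1" and "\<beta> \<equiv> \<tau> p $ 1 $ 2"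
  shows "\<eta> c (act p (upper (a, b)))
      (vector [v $ 1, v $ 2 * a + \<alpha> * a', v $ 2 * b + \<alpha> * b' + v $ 3 / a - \<beta> * a' / a\<^sup>2])
    = matrix_inv (upper (a, b)) ** \<eta> c p v ** upper (a, b)
      + vector [vector [a' / a, b' / a + b * a' / a\<^sup>2], vector [0, - (a' / a)]]"
proof -
  note F = trivialization_facts[OF pb tr]
  let ?q = "act p (upper (a, b))"
  let ?h = "a' / a" and ?k = "b' / a + b * a' / a\<^sup>2"
  have q: "\<pi> ?q \<in> V" using F(6)[OF a] p by simp
  have \<tau>q: "\<tau> ?q $ 1 $ 1 = \<alpha> * a" "\<tau> ?q $ 1 $ 2 = \<alpha> * b + \<beta> / a"
    using F(5)[OF p a, of b] unfolding frame_coords_def \<alpha>_def \<beta>_def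
    by (metis vector_3(2), metis vector_3(3))
  \<comment> \<open>\<open>?h\<close> and \<open>?k\<close> are the entries of \<open>g\<^sup>-\<^sup>1 dg\<close>, so the second summand is vertical at \<open>?q\<close>.\<close>
  have "vector [v $ 1, v $ 2 * a + \<alpha> * a', v $ 2 * b + \<alpha> * b' + v $ 3 / a - \<beta> * a' / a\<^sup>2]
      = vector [v $ 1, v $ 2 * a, v $ 2 * b + v $ 3 / a]
        + (vector [0, \<tau> ?q $ 1 $ 1 * ?h, \<tau> ?q $ 1 $ 1 * ?k - \<tau> ?q $ 1 $ 2 * ?h] :: complex^3)"
    unfolding \<tau>q using a by (intro vec3_eqI) (auto simp: field_simps power2_eq_square)
  then show ?thesis
    using connection_right_translation[OF pb tr cc p a] connection_vertical[OF pb tr cc q, of ?h ?k]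
      connection_add[OF cc F(1), of ?q] q
    unfolding c_def by simp
qed

section \<open>Coordinate changes between adapted charts\<close>

text \<open>
  The entries (2,1), (1,1), (1,2) of the matrix equation are, in turn, \<open>\<zeta>' = a\<^sup>2\<close>,
  \<open>0 = - a b + a'/a\<close> and \<open>0 = - b\<^sup>2 + b'/a + b a'/a\<^sup>2\<close>; the second turns the third into \<open>b' = 0\<close>.
\<close>

lemma adapted_frame_equations:
  assumes eq: "mat \<zeta>' ** a21 = matrix_inv (upper (a, b)) ** a21 ** upper (a, b)
      + vector [vector [a' / a, b' / a + b * a' / a\<^sup>2], vector [0, - (a' / a)]]"
    and a: "a \<noteq> 0"
  shows "\<zeta>' = a\<^sup>2" "a' = b * a\<^sup>2" "b' = 0"
proof -
  have e: "\<zeta>' = a * a" "a' / a = b * a" "b' / a + b * a' / a\<^sup>2 = b * b"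
    using eq a unfolding matrix_inv_upper[OF a]
    by (auto simp: upper_def a21_def mat_def matrix_matrix_mult_def sum_2 vec_eq_iff forall_2 algebra_simps)
  show "\<zeta>' = a\<^sup>2" using e(1) by (simp add: power2_eq_square)
  show a': "a' = b * a\<^sup>2" using e(2) a by (simp add: field_simps power2_eq_square)
  show "b' = 0" using e(3) a unfolding a' by simp
qed

text \<open>
  Both sections are read in one trivialization around \<open>x\<close>, as functions of the coordinate \<open>z\<close>. The
  section adapted to \<open>z'\<close> is holomorphic in \<open>z'\<close>, so its \<open>z\<close>-velocity is \<open>\<zeta>'\<close> times its
  \<open>z'\<close>-velocity by the chain rule, which is how \<open>\<zeta>' a21\<close> enters the gauge transformation law.
\<close>

lemma adapted_transition_equations:
  assumes rs: "riemann_surface S" and cps: "complex_projective_structure S P \<pi> act \<eta>"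
    and ad: "adapted S P \<pi> \<eta> (U, z)" and ad': "adapted S P \<pi> \<eta> (U, z')" and x: "x \<in> U"
  obtains D a b where "open D" "z x \<in> D" "D \<subseteq> z ` U"
    "\<And>t. t \<in> D \<Longrightarrow> a t \<noteq> 0"
    "\<And>t. t \<in> D \<Longrightarrow> deriv (z' \<circ> inv_into U z) t = a t ^ 2"
    "\<And>t. t \<in> D \<Longrightarrow> (a has_field_derivative b t * a t ^ 2) (at t)"
    "\<And>t. t \<in> D \<Longrightarrow> (b has_field_derivative 0) (at t)"
proof -
  have S: "maximal_atlas (\<lambda>f A. f holomorphic_on A) S" using rs by (simp add: riemann_surface_def)
  have pb: "principal_bundle S P \<pi> act" and cc: "cartan_connection P act \<eta>"
    using cps by (auto simp: complex_projective_structure_def)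
  obtain V w \<tau> where V: "x \<in> V" "(V, w) \<in> S" and tr: "trivialization P \<pi> act (V, w) \<tau>"
    using pb unfolding principal_bundle_def by blast
  note F = trivialization_facts[OF pb tr]
  let ?W = "\<pi> -` V" and ?\<Phi> = "frame_coords w \<pi> \<tau>"
  obtain \<pp> where U: "(U, z) \<in> S" and \<pp>: "holomorphic_section P \<pi> (U, z) \<pp>"
    and \<pp>\<eta>: "\<forall>(W, \<phi>)\<in>P. \<forall>x\<in>U. \<pp> x \<in> W \<longrightarrow>
          \<eta> (W, \<phi>) (\<pp> x) (\<chi> i. deriv (\<lambda>t. \<phi> (\<pp> (inv_into U z t)) $ i) (z x)) = a21"
    using ad unfolding adapted_def prod.case by blast
  obtain \<qq> where U': "(U, z') \<in> S" and \<qq>: "holomorphic_section P \<pi> (U, z') \<qq>"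
    and \<qq>\<eta>: "\<forall>(W, \<phi>)\<in>P. \<forall>x\<in>U. \<qq> x \<in> W \<longrightarrow>
          \<eta> (W, \<phi>) (\<qq> x) (\<chi> i. deriv (\<lambda>t. \<phi> (\<qq> (inv_into U z' t)) $ i) (z' x)) = a21"
    using ad' unfolding adapted_def prod.case by blast
  have pp_chart: "\<forall>(W, \<phi>)\<in>P. \<forall>i.
        (\<lambda>t. \<phi> (\<pp> (inv_into U z t)) $ i) holomorphic_on z ` (U \<inter> \<pp> -` W)"
    using \<pp> unfolding holomorphic_section_def prod.case by (elim conjE)
  have qq_chart: "\<forall>(W, \<phi>)\<in>P. \<forall>i.
        (\<lambda>t. \<phi> (\<qq> (inv_into U z' t)) $ i) holomorphic_on z' ` (U \<inter> \<qq> -` W)"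
    using \<qq> unfolding holomorphic_section_def prod.case by (elim conjE)
  have p\<pi>: "\<pi> (\<pp> y) = y" and q\<pi>: "\<pi> (\<qq> y) = y" if "y \<in> U" for y
    using \<pp> \<qq> that by (simp_all add: holomorphic_section_def)
  have dom: "U \<inter> \<pp> -` ?W = U \<inter> V" "U \<inter> \<qq> -` ?W = U \<inter> V"
    using p\<pi> q\<pi> by auto
  define D where "D = z ` (U \<inter> V)"
  define D' where "D' = z' ` (U \<inter> V)"
  have oD: "open D" "open D'"
    using transition(1)[OF S V(2) U] transition(1)[OF S V(2) U'] by (simp_all add: D_def D'_def Int_commute)
  have iz: "inj_on z U" and iz': "inj_on z' U"
    using transition(4)[OF S U V(2)] transition(4)[OF S U' V(2)] .
  define \<zeta> where "\<zeta> = z' \<circ> inv_into U z"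
  define \<xi> where "\<xi> = inv_into U z"
  have \<xi>: "\<xi> t \<in> U" "\<xi> t \<in> V" "z (\<xi> t) = t" "\<zeta> t = z' (\<xi> t)" "inv_into U z' (\<zeta> t) = \<xi> t" "\<zeta> t \<in> D'"
    if "t \<in> D" for t
    using that iz iz' by (auto simp: D_def D'_def \<xi>_def \<zeta>_def)
  have "\<zeta> holomorphic_on z ` (U \<inter> U)" unfolding \<zeta>_def using transition(2)[OF S U' U] .
  then have \<zeta>hol: "\<zeta> holomorphic_on D"
    by (rule holomorphic_on_subset) (auto simp: D_def)
  have \<zeta>d: "(\<zeta> has_field_derivative deriv \<zeta> t) (at t)" if "t \<in> D" for t
    using holomorphic_derivI[OF \<zeta>hol oD(1) that] .
  \<comment> \<open>\<open>p\<close> and \<open>q\<close> are the coordinates of the two sections along \<open>z\<close>; \<open>q'\<close> is \<open>q\<close> along \<open>z'\<close>.\<close>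
  define p where "p i t = ?\<Phi> (\<pp> (\<xi> t)) $ i" for i t
  define q where "q i t = ?\<Phi> (\<qq> (\<xi> t)) $ i" for i t
  define q' where "q' i t = ?\<Phi> (\<qq> (inv_into U z' t)) $ i" for i t
  have p_hol: "p i holomorphic_on D" for i
  proof -
    have "(\<lambda>t. ?\<Phi> (\<pp> (inv_into U z t)) $ i) holomorphic_on z ` (U \<inter> \<pp> -` ?W)"
      using bspec[OF pp_chart F(1)] by simp
    then show ?thesis unfolding dom by (simp add: p_def[abs_def] \<xi>_def D_def)
  qed
  have q'_hol: "q' i holomorphic_on D'" for i
  proof -
    have "(\<lambda>t. ?\<Phi> (\<qq> (inv_into U z' t)) $ i) holomorphic_on z' ` (U \<inter> \<qq> -` ?W)"
      using bspec[OF qq_chart F(1)] by simp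
    then show ?thesis unfolding dom by (simp add: q'_def[abs_def] D'_def)
  qed
  have pd: "(p i has_field_derivative deriv (p i) t) (at t)" if "t \<in> D" for i t
    using holomorphic_derivI[OF p_hol oD(1) that] .
  have qd: "(q i has_field_derivative deriv (q' i) (\<zeta> t) * deriv \<zeta> t) (at t)" if t: "t \<in> D" for i t
  proof -
    have "((\<lambda>t. q' i (\<zeta> t)) has_field_derivative deriv (q' i) (\<zeta> t) * deriv \<zeta> t) (at t)"
      using DERIV_chain2[OF holomorphic_derivI[OF q'_hol oD(2)] \<zeta>d] \<xi>(6) t by blast
    then show ?thesis
      by (rule has_field_derivative_transform_within_open[OF _ oD(1) t]) (simp add: q'_def q_def \<xi>(5))
  qed
  define a where "a t = q 2 t / p 2 t" for t
  define b where "b t = q 3 t / p 2 t - p 3 t / q 2 t" for t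
  have nz: "p 2 t \<noteq> 0" "q 2 t \<noteq> 0" if "t \<in> D" for t
    using F(4) p\<pi> q\<pi> \<xi>(1,2)[OF that] by (simp_all add: p_def q_def frame_coords_def)
  have an: "a t \<noteq> 0" if "t \<in> D" for t using nz[OF that] by (simp add: a_def)
  have gauge: "\<qq> (\<xi> t) = act (\<pp> (\<xi> t)) (upper (a t, b t))" if t: "t \<in> D" for t
    using frames_over_same_point[OF pb tr p\<pi>[OF \<xi>(1)[OF t]] q\<pi>[OF \<xi>(1)[OF t]] \<xi>(2)[OF t]]
    by (simp add: a_def b_def p_def q_def frame_coords_def)
  have ad: "(a has_field_derivative deriv a t) (at t)" and bd: "(b has_field_derivative deriv b t) (at t)"
    if t: "t \<in> D" for t
  proof -
    have "q i field_differentiable (at t)" "p i field_differentiable (at t)" for i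
      using pd[OF t] qd[OF t] by (auto simp: field_differentiable_def)
    then have "a field_differentiable (at t)" "b field_differentiable (at t)"
      unfolding a_def[abs_def] b_def[abs_def] using nz[OF t]
      by (auto intro!: field_differentiable_divide field_differentiable_diff)
    then show "(a has_field_derivative deriv a t) (at t)" "(b has_field_derivative deriv b t) (at t)"
      by (simp_all add: field_differentiable_derivI)
  qed
  have eqs: "deriv \<zeta> t = a t ^ 2" "deriv a t = b t * a t ^ 2" "deriv b t = 0" if t: "t \<in> D" for t
  proof -
    let ?y = "\<xi> t"
    define v where "v = (\<chi> i. deriv (p i) t)"
    define u where "u = (\<chi> i. deriv (q' i) (\<zeta> t))"
    have \<eta>p: "\<eta> (?W, ?\<Phi>) (\<pp> ?y) v = a21"
      using bspec[OF bspec[OF \<pp>\<eta> F(1), unfolded prod.case] \<xi>(1)[OF t]] \<xi>(2,3)[OF t] p\<pi>[OF \<xi>(1)[OF t]]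
      by (simp add: v_def p_def[abs_def] \<xi>_def)
    have \<eta>q: "\<eta> (?W, ?\<Phi>) (\<qq> ?y) u = a21"
      using bspec[OF bspec[OF \<qq>\<eta> F(1), unfolded prod.case] \<xi>(1)[OF t]] \<xi>(2,4)[OF t] q\<pi>[OF \<xi>(1)[OF t]]
      by (simp add: u_def q'_def[abs_def])
    \<comment> \<open>\<open>u1\<close>, \<open>u2\<close> and \<open>u3\<close> below compute the \<open>z\<close>-velocity of \<open>\<qq> = \<pp> g\<close> in two ways:
      from \<open>\<qq>\<close> by the chain rule and from \<open>\<pp> g\<close> by the product rule.\<close>
    have q1: "q 1 s = p 1 s" and q2: "q 2 s = p 2 s * a s" and q3: "q 3 s = p 2 s * b s + p 3 s / a s"
      if "s \<in> D" for s
      using nz[OF that] p\<pi>[OF \<xi>(1)[OF that]] q\<pi>[OF \<xi>(1)[OF that]]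
      by (simp_all add: p_def q_def frame_coords_def a_def b_def field_simps)
    have "(q 1 has_field_derivative v $ 1) (at t)"
      unfolding v_def
      by (rule has_field_derivative_transform_within_open[OF _ oD(1) t, of "p 1"]) (simp_all add: pd t q1)
    from DERIV_unique[OF qd[OF t] this] have u1: "deriv \<zeta> t * u $ 1 = v $ 1"
      by (simp add: u_def mult.commute)
    have "((\<lambda>s. p 2 s * a s) has_field_derivative v $ 2 * a t + p 2 t * deriv a t) (at t)"
      by (rule DERIV_cong[OF DERIV_mult[OF pd[OF t] ad[OF t]]]) (simp add: v_def)
    then have "(q 2 has_field_derivative v $ 2 * a t + p 2 t * deriv a t) (at t)"
      by (rule has_field_derivative_transform_within_open[OF _ oD(1) t]) (simp add: q2)
    from DERIV_unique[OF qd[OF t] this] have u2: "deriv \<zeta> t * u $ 2 = v $ 2 * a t + p 2 t * deriv a t"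
      by (simp add: u_def mult.commute)
    have "((\<lambda>s. p 2 s * b s + p 3 s / a s) has_field_derivative
        v $ 2 * b t + p 2 t * deriv b t + v $ 3 / a t - p 3 t * deriv a t / (a t)\<^sup>2) (at t)"
      by (rule DERIV_cong[OF DERIV_add[OF DERIV_mult[OF pd[OF t] bd[OF t]]
              DERIV_divide[OF pd[OF t] ad[OF t] an[OF t]]]])
        (use an[OF t] in \<open>simp add: v_def field_simps power2_eq_square\<close>)
    then have "(q 3 has_field_derivative
        v $ 2 * b t + p 2 t * deriv b t + v $ 3 / a t - p 3 t * deriv a t / (a t)\<^sup>2) (at t)"
      by (rule has_field_derivative_transform_within_open[OF _ oD(1) t]) (simp add: q3)
    from DERIV_unique[OF qd[OF t] this]
    have u3: "deriv \<zeta> t * u $ 3 = v $ 2 * b t + p 2 t * deriv b t + v $ 3 / a t - p 3 t * deriv a t / (a t)\<^sup>2"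
      by (simp add: u_def mult.commute)
    have "deriv \<zeta> t *s u = vector [v $ 1, v $ 2 * a t + p 2 t * deriv a t,
        v $ 2 * b t + p 2 t * deriv b t + v $ 3 / a t - p 3 t * deriv a t / (a t)\<^sup>2]"
      by (rule vec3_eqI) (simp_all add: u1 u2 u3)
    then have "mat (deriv \<zeta> t) ** a21
        = \<eta> (?W, ?\<Phi>) (\<qq> ?y) (vector [v $ 1, v $ 2 * a t + p 2 t * deriv a t,
            v $ 2 * b t + p 2 t * deriv b t + v $ 3 / a t - p 3 t * deriv a t / (a t)\<^sup>2])"
      using connection_scale[OF cc F(1), of "\<qq> ?y" "deriv \<zeta> t" u] \<eta>q \<xi>[OF t] q\<pi> by simp
    also have "\<dots> = matrix_inv (upper (a t, b t)) ** a21 ** upper (a t, b t)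
      + vector [vector [deriv a t / a t, deriv b t / a t + b t * deriv a t / (a t)\<^sup>2],
          vector [0, - (deriv a t / a t)]]"
      using connection_gauge_transformation[OF pb tr cc _ an[OF t], of "\<pp> ?y" "b t" v] \<eta>p \<xi>[OF t] p\<pi>
      by (simp add: gauge[OF t] p_def frame_coords_def)
    finally show "deriv \<zeta> t = a t ^ 2" "deriv a t = b t * a t ^ 2" "deriv b t = 0"
      using adapted_frame_equations an[OF t] by blast+
  qed
  show thesis
  proof (rule that[of D a b])
    show "z x \<in> D" "D \<subseteq> z ` U" using x V(1) by (auto simp: D_def)
  qed (use oD(1) an eqs ad bd \<zeta>_def in \<open>auto\<close>)
qed

section \<open>Meromorphic differentials\<close>

text \<open>
  A nicely meromorphic function has its limit as value, or 0 at a pole, and both depend only on the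
  punctured germ.
\<close>

lemma nicely_meromorphic_eqI:
  assumes "f nicely_meromorphic_on A" "g nicely_meromorphic_on A" "t \<in> A"
    and ev: "\<forall>\<^sub>F s in at t. f s = g s"
  shows "f t = g t"
proof -
  have "remove_sings h t = h t" if "h nicely_meromorphic_on A" for h
    using that assms(3) unfolding nicely_meromorphic_on_def by fastforce
  then show ?thesis using remove_sings_cong[OF ev refl] assms(1,2) by metis
qed

lemma
  assumes "Q \<in> meromorphic_differentials S U k" and V: "(V, w) \<in> S"
  shows meromorphic_differential_coefficient: "(Q (V, w) \<circ> inv_into V w) nicely_meromorphic_on w ` (U \<inter> V)"
    and meromorphic_differential_change_of_chart: "(V', w') \<in> S \<Longrightarrow> x \<in> U \<inter> V \<inter> V' \<Longrightarrow>
      Q (V, w) x = Q (V', w') x * deriv (w' \<circ> inv_into V w) (w x) ^ k"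
proof -
  have 1: "\<forall>(V, w)\<in>S. (Q (V, w) \<circ> inv_into V w) nicely_meromorphic_on w ` (U \<inter> V)"
    and 2: "\<forall>(V, w)\<in>S. \<forall>(V', w')\<in>S. \<forall>x\<in>U \<inter> V \<inter> V'.
        Q (V, w) x = Q (V', w') x * deriv (w' \<circ> inv_into V w) (w x) ^ k"
    using assms(1) unfolding meromorphic_differentials_def mem_Collect_eq by simp_all
  show "(Q (V, w) \<circ> inv_into V w) nicely_meromorphic_on w ` (U \<inter> V)"
    using bspec[OF 1 V] by simp
  show "Q (V, w) x = Q (V', w') x * deriv (w' \<circ> inv_into V w) (w x) ^ k"
    if V': "(V', w') \<in> S" and x: "x \<in> U \<inter> V \<inter> V'"
    using bspec[OF bspec[OF bspec[OF 2 V, unfolded prod.case] V', unfolded prod.case] x] .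
qed

lemma meromorphic_differential_eqI:
  assumes S: "(U, z) \<in> S"
    and Q: "Q \<in> meromorphic_differentials S U k" and R: "R \<in> meromorphic_differentials S U k"
    and eq: "\<And>x. x \<in> U \<Longrightarrow> Q (U, z) x = R (U, z) x"
  shows "Q = R"
proof (intro ext, clarify)
  fix V w x
  show "Q (V, w) x = R (V, w) x"
  proof (cases "(V, w) \<in> S \<and> x \<in> U \<inter> V")
    case True
    have T: "T (V, w) x = T (U, z) x * deriv (z \<circ> inv_into V w) (w x) ^ k"
      if "T \<in> meromorphic_differentials S U k" for T
      using meromorphic_differential_change_of_chart[OF that _ S, of V w x] True by blast
    show ?thesis using T[OF Q] T[OF R] eq True by simp
  next
    case False
    have T: "T (V, w) x = 0" if "T \<in> meromorphic_differentials S U k" for T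
      using that False unfolding meromorphic_differentials_def by blast
    show ?thesis using T[OF Q] T[OF R] by simp
  qed
qed

section \<open>Independence of the adapted chart\<close>

lemma dop_coefficient:
  assumes Q: "Q \<in> meromorphic_differentials S U 4" "Q \<noteq> (\<lambda>_ _. 0)"
    and V: "(V, w) \<in> S" "x \<in> U \<inter> V"
  shows "dop S (U, z) Q (V, w) x = remove_sings (quartic_operator (Q (U, z) \<circ> inv_into U z)) (z x)
    * deriv (z \<circ> inv_into V w) (w x) ^ 2"
  using assms by (simp add: dop_def Let_def differential_of_def quartic_operator_def[abs_def])

theorem lemma3:
  fixes S :: "('a::t2_space, complex) chart set"
    and P :: "('p::t2_space, complex^3) chart set"
    and \<pi> :: "'p \<Rightarrow> 'a"
    and act :: "'p \<Rightarrow> complex^2^2 \<Rightarrow> 'p"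
    and \<eta> :: "'p mform"
    and U :: "'a set"
    and z z' :: "'a \<Rightarrow> complex"
  assumes "riemann_surface S"
    and "complex_projective_structure S P \<pi> act \<eta>"
    and "adapted S P \<pi> \<eta> (U, z)"
    and "adapted S P \<pi> \<eta> (U, z')"
  shows "dop S (U, z) = dop S (U, z')"
proof
  fix Q
  have S: "maximal_atlas (\<lambda>f A. f holomorphic_on A) S" using assms(1) by (simp add: riemann_surface_def)
  have U: "(U, z) \<in> S" and U': "(U, z') \<in> S" using assms(3,4) by (auto simp: adapted_def)
  consider "Q \<notin> meromorphic_differentials S U 4" | "Q = (\<lambda>_ _. 0)"
    | "Q \<in> meromorphic_differentials S U 4" "Q \<noteq> (\<lambda>_ _. 0)" by blast
  then show "dop S (U, z) Q = dop S (U, z') Q"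
  proof cases
    case 1
    then show ?thesis by (simp add: dop_def)
  next
    case 2
    then show ?thesis by (simp add: dop_def restrict_def)
  next
    case 3
    let ?R = "dop S (U, z) Q" and ?R' = "dop S (U, z') Q"
    have R: "?R \<in> meromorphic_differentials S U 2" "?R' \<in> meromorphic_differentials S U 2"
      using dop_in_meromorphic_differentials[OF assms(1)] U U' 3(1) by (auto simp: PiE_def Pi_def)
    define \<xi> where "\<xi> = inv_into U z"
    define \<zeta> where "\<zeta> = z' \<circ> \<xi>"
    define Z where "Z = Q (U, z) \<circ> \<xi>"
    define Y where "Y = Q (U, z') \<circ> inv_into U z'"
    have iz: "inj_on z U" and iz': "inj_on z' U"
      using transition(4)[OF S U U] transition(4)[OF S U' U] .
    have oz: "open (z ` U)" using transition(1)[OF S U U] by simp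
    have \<xi>: "\<xi> t \<in> U" "z (\<xi> t) = t" "\<zeta> t = z' (\<xi> t)" "inv_into U z' (\<zeta> t) = \<xi> t" "\<zeta> t \<in> z' ` U"
      if "t \<in> z ` U" for t
      using that iz iz' by (auto simp: \<xi>_def \<zeta>_def)
    have "(Q (U, z) \<circ> inv_into U z) nicely_meromorphic_on z ` (U \<inter> U)"
      "(Q (U, z') \<circ> inv_into U z') nicely_meromorphic_on z' ` (U \<inter> U)"
      using meromorphic_differential_coefficient[OF 3(1)] U U' by blast+
    then have mer: "Z meromorphic_on z ` U" "Y meromorphic_on z' ` U"
      by (simp_all add: nicely_meromorphic_on_def Z_def Y_def \<xi>_def)
    have merop: "quartic_operator Z meromorphic_on z ` U" "quartic_operator Y meromorphic_on z' ` U"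
      unfolding quartic_operator_def[abs_def] by (intro meromorphic_intros mer)+
    have \<zeta>hol: "\<zeta> holomorphic_on z ` U" using transition(2)[OF S U' U] by (simp add: \<zeta>_def \<xi>_def)
    have \<zeta>d: "(\<zeta> has_field_derivative deriv \<zeta> t) (at t)" if "t \<in> z ` U" for t
      using holomorphic_derivI[OF \<zeta>hol oz that] .
    have \<zeta>inj: "inj_on \<zeta> (z ` U)" using transition(5)[OF S U' U] by (simp add: \<zeta>_def \<xi>_def)
    have ZY: "Z t = Y (\<zeta> t) * deriv \<zeta> t ^ 4" if t: "t \<in> z ` U" for t
    proof -
      have "Q (U, z) (\<xi> t) = Q (U, z') (\<xi> t) * deriv (z' \<circ> inv_into U z) (z (\<xi> t)) ^ 4"
        using meromorphic_differential_change_of_chart[OF 3(1) U U'] \<xi>(1)[OF t] by blast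
      then show ?thesis using \<xi>[OF t] by (simp add: Z_def Y_def \<zeta>_def \<xi>_def)
    qed
    \<comment> \<open>A differential on \<open>U\<close> is determined by its coefficient in the chart \<open>(U, z)\<close>.\<close>
    have coeff: "?R (U, z) (\<xi> t) = remove_sings (quartic_operator Z) t"
      "?R' (U, z) (\<xi> t) = remove_sings (quartic_operator Y) (\<zeta> t) * deriv \<zeta> t ^ 2"
      if t: "t \<in> z ` U" for t
    proof -
      have "deriv (z \<circ> inv_into U z) t = deriv (\<lambda>s. s) t"
        by (rule deriv_cong_ev[OF _ refl])
          (use t oz \<xi>(2) in \<open>auto simp: eventually_nhds \<xi>_def intro!: exI[of _ "z ` U"]\<close>)
      then show "?R (U, z) (\<xi> t) = remove_sings (quartic_operator Z) t"
        using dop_coefficient[OF 3 U, of "\<xi> t" z] \<xi>[OF t] by (simp add: Z_def \<xi>_def)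
      show "?R' (U, z) (\<xi> t) = remove_sings (quartic_operator Y) (\<zeta> t) * deriv \<zeta> t ^ 2"
        using dop_coefficient[OF 3 U, of "\<xi> t" z'] \<xi>[OF t] by (simp add: Y_def \<zeta>_def \<xi>_def)
    qed
    show ?thesis
    proof (rule meromorphic_differential_eqI[OF U R])
      fix x assume x: "x \<in> U"
      obtain D a b where D: "open D" "z x \<in> D" "D \<subseteq> z ` U"
        and a: "\<And>t. t \<in> D \<Longrightarrow> a t \<noteq> 0"
        and \<zeta>': "\<And>t. t \<in> D \<Longrightarrow> deriv \<zeta> t = a t ^ 2"
        and a': "\<And>t. t \<in> D \<Longrightarrow> (a has_field_derivative b t * a t ^ 2) (at t)"
        and b': "\<And>t. t \<in> D \<Longrightarrow> (b has_field_derivative 0) (at t)"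
        using adapted_transition_equations[OF assms x] unfolding \<zeta>_def \<xi>_def by metis
      let ?t = "z x"
      have t: "?t \<in> z ` U" using x by simp
      \<comment> \<open>Near \<open>?t\<close>, but away from it, no removal of singularities takes place and \<open>Y\<close> is analytic;
        \<open>\<zeta>\<close> is continuous and injective, so it maps punctured neighbourhoods of \<open>?t\<close> into
        punctured neighbourhoods of its image.\<close>
      have fl: "filterlim \<zeta> (at (\<zeta> ?t)) (at ?t)"
        unfolding filterlim_at
      proof
        have "\<zeta> s \<noteq> \<zeta> ?t" if "s \<in> D" "s \<noteq> ?t" for s
          using inj_onD[OF \<zeta>inj _ _ t] that D(3) by blast
        then show "\<forall>\<^sub>F s in at ?t. \<zeta> s \<in> UNIV \<and> \<zeta> s \<noteq> \<zeta> ?t"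
          using D unfolding eventually_at_topological by (intro exI[of _ D]) simp
        show "\<zeta> \<midarrow>?t\<rightarrow> \<zeta> ?t" using DERIV_isCont[OF \<zeta>d[OF t]] by (rule isContD)
      qed
      have an: "\<forall>\<^sub>F u in at (\<zeta> ?t). Y analytic_on {u}"
        using bspec[OF mer(2)[unfolded meromorphic_on_altdef] \<xi>(5)[OF t]]
        by (simp add: isolated_singularity_at_altdef)
      have evY: "\<forall>\<^sub>F u in at (\<zeta> ?t). remove_sings (quartic_operator Y) u = quartic_operator Y u"
        and evZ: "\<forall>\<^sub>F s in at ?t. remove_sings (quartic_operator Z) s = quartic_operator Z s"
        using bspec[OF merop(2)[unfolded meromorphic_on_altdef] \<xi>(5)[OF t]]
          bspec[OF merop(1)[unfolded meromorphic_on_altdef] t]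
        by (blast intro: eventually_remove_sings_eq_at)+
      have "\<forall>\<^sub>F s in at ?t. (?R (U, z) \<circ> \<xi>) s = (?R' (U, z) \<circ> \<xi>) s"
        using evZ filterlim_iff[THEN iffD1, OF fl, rule_format, OF evY]
          filterlim_iff[THEN iffD1, OF fl, rule_format, OF an] eventually_at_in_open'[OF D(1,2)]
      proof eventually_elim
        case (elim s)
        then have s: "s \<in> z ` U" using D(3) by blast
        have "quartic_operator Z s = quartic_operator Y (\<zeta> s) * (a s ^ 2) ^ 2"
          by (rule quartic_operator_covariant[OF D(1) elim(4) a[OF elim(4)] _ a' b'])
            (use elim D(3) \<zeta>' \<zeta>d ZY in \<open>force+\<close>)
        then show ?case using elim coeff[OF s] \<zeta>'[OF elim(4)] by simp
      qed
      moreover have "(T (U, z) \<circ> \<xi>) nicely_meromorphic_on z ` U" if "T \<in> meromorphic_differentials S U 2" for T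
      proof -
        have "(T (U, z) \<circ> inv_into U z) nicely_meromorphic_on z ` (U \<inter> U)"
          by (rule meromorphic_differential_coefficient[OF that U])
        then show ?thesis by (simp add: \<xi>_def)
      qed
      ultimately have "(?R (U, z) \<circ> \<xi>) ?t = (?R' (U, z) \<circ> \<xi>) ?t"
        using nicely_meromorphic_eqI R t by blast
      then show "?R (U, z) x = ?R' (U, z) x" using x iz by (simp add: \<xi>_def)
    qed
  qed
qed

end
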